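(* Let $q$ be a prime power and let $m,n$ be positive integers with $\gcd(n,m)=1$. Let $k<n$ be a positive integer. Let $\mathcal{M}$ be an $\mathbb{F}_{q^m}$-linear MRD code consisting of $q^m$-polynomials over $\mathbb{F}_{q^{mn}}$, with $\#\mathcal{M}=q^{mnk}$. Let $\widetilde{\mathcal{M}}$ be the intersection of $\mathcal{M}$ with the set of $q$-polynomials over $\mathbb{F}_{q^n}$. Then $\widetilde{\mathcal{M}}$ is an $\mathbb{F}_q$-linear MRD code if and only if $\#\widetilde{\mathcal{M}}=q^{nk}$.
   Context: A $q^m$-polynomial over $\mathbb{F}_{q^{mn}}$ is a polynomial $\sum_{i=0}^{n-1}a_ix^{q^{mi}}$ with $a_i\in\mathbb{F}_{q^{mn}}$; it defines an $\mathbb{F}_{q^m}$-linear map of $\mathbb{F}_{q^{mn}}$ (an $n$-dimensional $\mathbb{F}_{q^m}$-space), hence an $n\times n$ matrix over $\mathbb{F}_{q^m}$. A $q$-polynomial over $\mathbb{F}_{q^n}$ is a polynomial $\sum_{i=0}^{n-1}a_ix^{q^i}$ with $a_i\in\mathbb{F}_{q^n}$, regarded (modulo $x^{q^n}-x$) as an $\mathbb{F}_q$-linear map of $\mathbb{F}_{q^n}$, hence an $n\times n$ matrix over $\mathbb{F}_q$; a $q^m$-polynomial whose coefficients all lie in $\mathbb{F}_{q^n}$ maps $\mathbb{F}_{q^n}$ into itself and is regarded in this way as a $q$-polynomial over $\mathbb{F}_{q^n}$. For a set $\mathcal{C}$ of $n\times n$ matrices over a finite field $\mathbb{F}_Q$,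 the rank distance is $d(A,B)=\mathrm{rank}(A-B)$ and the minimum distance $d(\mathcal{C})$ is the minimum of $d(A,B)$ over distinct $A,B\in\mathcal{C}$; the Singleton bound states $\#\mathcal{C}\le Q^{n(n-d(\mathcal{C})+1)}$, and $\mathcal{C}$ is a maximum rank distance (MRD) code if equality holds. A code is $\mathbb{F}_Q$-linear if it is an $\mathbb{F}_Q$-subspace.
   Formalization: On the left of the equivalence, the formal statement also requires that the intersection code have the same minimum distance as M; without this the "only if" direction is false (q=2, m=2, n=3, k=2, M={ax+b(gx^4+x^16)}, g a generator of F_64^* ). *)

theory Defs
  imports "HOL-Algebra.Algebra" "HOL-Number_Theory.Prime_Powers"
begin

text \<open>
  All fields live inside one ambient field \<open>R\<close>. A subfield \<open>K\<close> of \<open>R\<close> and a \<open>K\<close>-subspace \<open>V\<close> of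
  \<open>R\<close> are given by their carriers, as in \<^theory>\<open>HOL-Algebra.Embedded_Algebras\<close>. With
  \<open>n = dim\<^sub>K V\<close>, an \<open>n \<times> n\<close> matrix over \<open>K\<close> is a \<open>K\<close>-linear endomorphism of \<open>V\<close>, its rank is the
  dimension of the image, and a code is a set of such endomorphisms. The maps are extensional on
  \<open>V\<close>, so that equality and cardinality of codes are those of the matrices.
\<close>

definition endos :: "('a, 'b) ring_scheme \<Rightarrow> 'a set \<Rightarrow> 'a set \<Rightarrow> ('a \<Rightarrow> 'a) set" where
  "endos R K V = {f \<in> V \<rightarrow>\<^sub>E V.
     (\<forall>x\<in>V. \<forall>y\<in>V. f (x \<oplus>\<^bsub>R\<^esub> y) = f x \<oplus>\<^bsub>R\<^esub> f y) \<and>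
     (\<forall>c\<in>K. \<forall>x\<in>V. f (c \<otimes>\<^bsub>R\<^esub> x) = c \<otimes>\<^bsub>R\<^esub> f x)}"

definition rank :: "('a, 'b) ring_scheme \<Rightarrow> 'a set \<Rightarrow> 'a set \<Rightarrow> ('a \<Rightarrow> 'a) \<Rightarrow> nat" where
  "rank R K V f = ring.dim R K (f ` V)"

definition rank_dist ::
    "('a, 'b) ring_scheme \<Rightarrow> 'a set \<Rightarrow> 'a set \<Rightarrow> ('a \<Rightarrow> 'a) \<Rightarrow> ('a \<Rightarrow> 'a) \<Rightarrow> nat" where
  "rank_dist R K V f g = rank R K V (\<lambda>x\<in>V. f x \<ominus>\<^bsub>R\<^esub> g x)"

text \<open>Meaningful only for a finite code with at least two elements.\<close>

definition min_dist :: "('a, 'b) ring_scheme \<Rightarrow> 'a set \<Rightarrow> 'a set \<Rightarrow> ('a \<Rightarrow> 'a) set \<Rightarrow> nat" where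
  "min_dist R K V C = Min {rank_dist R K V f g | f g. f \<in> C \<and> g \<in> C \<and> f \<noteq> g}"

text \<open>
  Equality in the Singleton bound. A code with at most one element has no minimum distance and is
  not MRD. The truncated subtraction is harmless, as a rank is at most \<open>dim\<^sub>K V\<close>.
  MRD codes in the same \<open>V\<close> may have different minimum distances; a statement about MRD codes of one
  given distance has to say so in terms of \<open>min_dist\<close>.
\<close>

definition mrd_code :: "('a, 'b) ring_scheme \<Rightarrow> 'a set \<Rightarrow> 'a set \<Rightarrow> ('a \<Rightarrow> 'a) set \<Rightarrow> bool" where
  "mrd_code R K V C \<longleftrightarrow>
     C \<subseteq> endos R K V \<and> (\<exists>f\<in>C. \<exists>g\<in>C. f \<noteq> g) \<and>
     card C = card K ^ (ring.dim R K V * (ring.dim R K V - min_dist R K V C + 1))"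

definition linear_code :: "('a, 'b) ring_scheme \<Rightarrow> 'a set \<Rightarrow> 'a set \<Rightarrow> ('a \<Rightarrow> 'a) set \<Rightarrow> bool" where
  "linear_code R K V C \<longleftrightarrow>
     C \<subseteq> endos R K V \<and> (\<lambda>x\<in>V. \<zero>\<^bsub>R\<^esub>) \<in> C \<and>
     (\<forall>f\<in>C. \<forall>g\<in>C. (\<lambda>x\<in>V. f x \<oplus>\<^bsub>R\<^esub> g x) \<in> C) \<and>
     (\<forall>c\<in>K. \<forall>f\<in>C. (\<lambda>x\<in>V. c \<otimes>\<^bsub>R\<^esub> f x) \<in> C)"

text \<open>The polynomials \<open>\<Sum>i<n. a\<^sub>i x^(Q^i)\<close> over \<open>R\<close> with all coefficients \<open>a\<^sub>i\<close> in \<open>L\<close>.\<close>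

definition lin_polys :: "('a, 'b) ring_scheme \<Rightarrow> nat \<Rightarrow> nat \<Rightarrow> 'a set \<Rightarrow> (nat \<Rightarrow> 'a) set" where
  "lin_polys R Q n L =
     {(\<Oplus>\<^bsub>UP R\<^esub> i\<in>{..<n}. up_ring.monom (UP R) (a i) (Q ^ i)) | a. a \<in> {..<n} \<rightarrow> L}"

definition poly_map :: "('a, 'b) ring_scheme \<Rightarrow> 'a set \<Rightarrow> (nat \<Rightarrow> 'a) \<Rightarrow> 'a \<Rightarrow> 'a" where
  "poly_map R V p = (\<lambda>x\<in>V. UnivPoly.eval R R id x p)"

end

theory Submission
  imports Defs
begin

text \<open>
  Since \<open>gcd m n = 1\<close>, the space spanned by \<open>F\<^bsub>q^n\<^esub>\<close> over \<open>F\<^bsub>q^m\<^esub>\<close> is the whole field. Hence the image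
  of an \<open>F\<^bsub>q^m\<^esub>\<close>-linear map \<open>f\<close> that preserves \<open>F\<^bsub>q^n\<^esub>\<close> is spanned over \<open>F\<^bsub>q^m\<^esub>\<close> by any
  \<open>F\<^sub>q\<close>-basis of \<open>f(F\<^bsub>q^n\<^esub>)\<close>, so restricting \<open>f\<close> to \<open>F\<^bsub>q^n\<^esub>\<close> does not lower its rank. The
  restricted code therefore keeps its cardinality and has minimum distance at least \<open>n - k + 1\<close>;
  when it has \<open>q^(n * k)\<close> elements, the Singleton bound gives the reverse inequality.
\<close>

subsection \<open>Dimension and linear maps over finite subfields\<close>

context ring
begin

text \<open>As a simp rule this equation would unfold every \<open>Span\<close> and hide it from the
  lemmas about spans.\<close>

declare Span.simps [simp del]

lemma dim_Span_le:
  assumes K: "subfield K R" and "set Us \<subseteq> carrier R"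
  shows "dim K (Span K Us) \<le> length Us"
proof -
  have "\<exists>Vs. independent K Vs \<and> Span K Vs = Span K Us \<and> length Vs \<le> length Us"
    using assms(2)
  proof (induction Us)
    case Nil
    then show ?case by (intro exI[of _ "[]"]) (auto simp: Span.simps)
  next
    case (Cons u Us)
    then obtain Vs where Vs: "independent K Vs" "Span K Vs = Span K Us" "length Vs \<le> length Us"
      by auto
    show ?case
    proof (cases "u \<in> Span K Us")
      case True
      have "Span K (u # Us) \<subseteq> Span K Us"
        using True Cons.prems Span_base_incl[OF K, of Us] by (intro mono_Span_subset[OF K]) auto
      moreover have "Span K Us \<subseteq> Span K (u # Us)"
        using mono_Span[OF K, of Us u] Cons.prems by auto
      ultimately show ?thesis using Vs by (intro exI[of _ Vs]) auto
    next
      case False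
      then have "independent K (u # Vs)"
        using Vs Cons.prems by (intro li_Cons) auto
      then show ?thesis using Vs by (intro exI[of _ "u # Vs"]) (auto simp: Span.simps)
    qed
  qed
  then obtain Vs where Vs: "independent K Vs" "Span K Vs = Span K Us" "length Vs \<le> length Us"
    by blast
  have "dim K (Span K Us) = length Vs"
    using dimI[OF K dimensionI[OF K Vs(1,2)]] by (simp add: over_def)
  then show ?thesis using Vs(3) by simp
qed

text \<open>Coordinates with respect to a base give a bijection between the lists of
  \<open>n\<close> scalars and \<open>E\<close>.\<close>

lemma card_dimension:
  assumes K: "subfield K R" and "finite K" and "dimension n K E"
  shows "card E = card K ^ n"
proof -
  obtain Us where Us: "set Us \<subseteq> carrier R" "independent K Us" "length Us = n" "Span K Us = E"
    using exists_base[OF K assms(3)] by blast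
  let ?L = "{Ks. set Ks \<subseteq> K \<and> length Ks = n}"
  have *: "x \<in> E \<longleftrightarrow> (\<exists>Ks\<in>?L. x = combine Ks Us)" for x
    using Span_mem_iff_length_version[OF K Us(1), of x] Us(3,4) by auto
  have "bij_betw (\<lambda>Ks. combine Ks Us) ?L E"
  proof (rule bij_betwI')
    fix Ks Ks' assume L: "Ks \<in> ?L" "Ks' \<in> ?L"
    then have "combine Ks Us \<in> Span K Us" using * Us(4) by blast
    from unique_decomposition[OF K Us(2) this] L Us(3)
    show "(combine Ks Us = combine Ks' Us) = (Ks = Ks')" by auto
  qed (use * in blast)+
  then have "card E = card ?L" by (simp add: bij_betw_same_card)
  then show ?thesis using card_lists_length_eq[OF assms(2), of n] by simp
qed

text \<open>A finite space is spanned by the list of all its elements.\<close>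

lemma finite_subalgebra_dimension:
  assumes K: "subfield K R" and E: "subalgebra K E R" and "finite E"
  shows "dimension (dim K E) K E"
proof -
  obtain Us where Us: "set Us = E" using finite_list[OF assms(3)] by blast
  have EC: "E \<subseteq> carrier R" by (rule subalgebra_in_carrier[OF E])
  have "Span K Us = E"
    using Span_base_incl[OF K, of Us] subalgebra_Span_incl[OF K E, of Us] Us EC by auto
  then have "finite_dimension K E"
    using Span_finite_dimension[OF K, of Us] Us EC by auto
  then show ?thesis using finite_dimensionE[OF K] by (simp add: over_def)
qed

lemma subfield_subalgebra:
  assumes K: "subfield K R" and L: "subfield L R" and "K \<subseteq> L"
  shows "subalgebra K L R"
  using subring.axioms(1)[OF subfieldE(1)[OF L]] assms(3) subringE(6)[OF subfieldE(1)[OF L]]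
  by (auto simp: subalgebra_def subalgebra_axioms_def)

text \<open>A power of a base that is at least 2 determines its exponent, so counting elements
  determines the dimension.\<close>

lemma dimension_of_card:
  assumes K: "subfield K R" and E: "subalgebra K E R" and "finite E" "finite K" "card K \<ge> 2"
    and "card E = card K ^ n"
  shows "dimension n K E"
proof -
  have "card K ^ dim K E = card K ^ n"
    using card_dimension[OF K assms(4) finite_subalgebra_dimension[OF K E assms(3)]] assms(6)
    by simp
  then have "dim K E = n" using assms(5) by simp
  then show ?thesis using finite_subalgebra_dimension[OF K E assms(3)] by simp
qed

text \<open>\<open>combine\<close> stops at the end of the shorter list and \<open>map f\<close>
  keeps the length, so the two lists may differ in length. Membership in \<open>V\<close> is carried
  along because additivity of \<open>f\<close> is known on \<open>V\<close> only.\<close>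

lemma endos_combine:
  assumes V: "subalgebra K V R" and K: "K \<subseteq> carrier R" and f: "f \<in> endos R K V"
    and "set Ks \<subseteq> K" "set Us \<subseteq> V"
  shows "f (combine Ks Us) = combine Ks (map f Us) \<and> combine Ks Us \<in> V"
proof -
  interpret V: subalgebra K V R by (rule V)
  have VC: "V \<subseteq> carrier R" by (rule subalgebra_in_carrier[OF V])
  have z: "\<zero> \<in> V" using V.one_closed by simp
  have add: "x \<oplus> y \<in> V" if "x \<in> V" "y \<in> V" for x y using V.m_closed that by simp
  \<comment> \<open>Cancellation in \<open>f \<zero> \<oplus> f \<zero> = f \<zero>\<close>, which
    is additivity at zero.\<close>
  have fz: "f \<zero> = \<zero>"
  proof -
    have "f \<zero> \<in> carrier R" "f \<zero> \<oplus> f \<zero> = f (\<zero> \<oplus> \<zero>)"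
      using f z VC unfolding endos_def by (auto dest!: PiE_mem simp del: r_zero l_zero)
    then show ?thesis by simp
  qed
  show ?thesis using assms(4,5)
  proof (induction Ks Us rule: combine.induct)
    case (1 k Ks u Us)
    then show ?case using f add V.smult_closed by (auto simp: endos_def)
  qed (use fz z in auto)
qed

lemma endos_Span:
  assumes V: "subalgebra K V R" and K: "subfield K R" and f: "f \<in> endos R K V"
    and "set Us \<subseteq> V"
  shows "f ` Span K Us = Span K (map f Us)"
proof -
  have VC: "V \<subseteq> carrier R" by (rule subalgebra_in_carrier[OF V])
  have "set (map f Us) \<subseteq> carrier R" using f VC assms(4) by (auto simp: endos_def dest!: PiE_mem)
  then have *: "Span K (map f Us) = {combine Ks (map f Us) | Ks. set Ks \<subseteq> K}"
    using Span_eq_combine_set[OF K] by blast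
  have "Span K Us = {combine Ks Us | Ks. set Ks \<subseteq> K}"
    using Span_eq_combine_set[OF K, of Us] VC assms(4) by blast
  then have "f ` Span K Us = {f (combine Ks Us) | Ks. set Ks \<subseteq> K}" by auto
  also have "\<dots> = {combine Ks (map f Us) | Ks. set Ks \<subseteq> K}"
    using endos_combine[OF V subfieldE(3)[OF K] f _ assms(4)] by metis
  finally show ?thesis using * by simp
qed

lemma endos_image_subalgebra:
  assumes V: "subalgebra K V R" and K: "subfield K R" and f: "f \<in> endos R K V" and "finite V"
  shows "subalgebra K (f ` V) R"
proof -
  obtain Us where Us: "set Us = V" using finite_list[OF assms(4)] by blast
  have VC: "V \<subseteq> carrier R" by (rule subalgebra_in_carrier[OF V])
  have "Span K Us = V"
    using Span_base_incl[OF K, of Us] subalgebra_Span_incl[OF K V, of Us] Us VC by auto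
  then have "f ` V = Span K (map f Us)" using endos_Span[OF V K f, of Us] Us by simp
  moreover have "set (map f Us) \<subseteq> carrier R" using f VC Us by (auto simp: endos_def dest!: PiE_mem)
  ultimately show ?thesis using Span_is_subalgebra[OF K] by simp
qed

end

lemma (in cring) endos_diff:
  assumes V: "subalgebra K V R" and K: "K \<subseteq> carrier R" and f: "f \<in> endos R K V" and g: "g \<in> endos R K V"
  shows "(\<lambda>x\<in>V. f x \<ominus> g x) \<in> endos R K V"
proof -
  interpret V: subalgebra K V R by (rule V)
  have VC: "V \<subseteq> carrier R" by (rule subalgebra_in_carrier[OF V])
  have add: "x \<oplus> y \<in> V" if "x \<in> V" "y \<in> V" for x y using V.m_closed that by simp
  have min: "x \<ominus> y \<in> V" if "x \<in> V" "y \<in> V" for x y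
    using add V.m_inv_closed that unfolding a_minus_def a_inv_def by auto
  have fV: "f x \<in> V" "g x \<in> V" if "x \<in> V" for x
    using f g that by (auto simp: endos_def)
  have fC: "f x \<in> carrier R" "g x \<in> carrier R" if "x \<in> V" for x
    using fV VC that by auto
  have fadd: "f (x \<oplus> y) = f x \<oplus> f y" "g (x \<oplus> y) = g x \<oplus> g y" if "x \<in> V" "y \<in> V" for x y
    using f g that by (auto simp: endos_def)
  have fsm: "f (c \<otimes> x) = c \<otimes> f x" "g (c \<otimes> x) = c \<otimes> g x" if "c \<in> K" "x \<in> V" for c x
    using f g that by (auto simp: endos_def)
  have "f (x \<oplus> y) \<ominus> g (x \<oplus> y) = (f x \<ominus> g x) \<oplus> (f y \<ominus> g y)" if "x \<in> V" "y \<in> V" for x y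
    using fC[OF that(1)] fC[OF that(2)] by (simp add: fadd that minus_eq minus_add a_ac)
  moreover have "f (c \<otimes> x) \<ominus> g (c \<otimes> x) = c \<otimes> (f x \<ominus> g x)" if "c \<in> K" "x \<in> V" for c x
    using fC[OF that(2)] subsetD[OF K that(1)] by (simp add: fsm that minus_eq r_distr r_minus)
  moreover have "f x \<ominus> g x \<in> V" if "x \<in> V" for x
    using fV that by (intro min)
  ultimately show ?thesis
    using add V.smult_closed unfolding endos_def by simp
qed

subsection \<open>The Singleton bound\<close>

text \<open>A map in \<open>C\<close> is determined by its values on the first
  \<open>n - d + 1\<close> base vectors: two maps that agree there differ by a map whose image is
  spanned by fewer than \<open>d\<close> vectors. Counting the possible lists of values gives the
  bound.\<close>

theorem (in cring) singleton_bound: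
  assumes K: "subfield K R" and "finite K" and n: "dimension n K V" and C: "C \<subseteq> endos R K V"
    and d: "d > 0" "\<And>f g. \<lbrakk>f \<in> C; g \<in> C; f \<noteq> g\<rbrakk> \<Longrightarrow> d \<le> rank_dist R K V f g"
  shows "card C \<le> card K ^ (n * (n - d + 1))"
proof -
  have V: "subalgebra K V R"
    by (rule finite_dimension_imp_subalgebra[OF K finite_dimensionI[OF n]])
  have K': "K \<subseteq> carrier R" by (rule subfieldE(3)[OF K])
  have VC: "V \<subseteq> carrier R" by (rule subalgebra_in_carrier[OF V])
  have cV: "card V = card K ^ n" by (rule card_dimension[OF K assms(2) n])
  have K1: "card K > 0" using subfieldE(6)[OF K] subringE(3)[OF subfieldE(1)[OF K]] assms(2)
    by (auto simp: card_gt_0_iff)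
  then have finV: "finite V" using cV by (intro card_ge_0_finite) simp
  obtain Us where Us: "set Us \<subseteq> carrier R" "independent K Us" "length Us = n" "Span K Us = V"
    using exists_base[OF K n] by blast
  have UV: "set Us \<subseteq> V" using Span_base_incl[OF K Us(1)] Us(4) by simp
  define As Bs where "As = take (n - d + 1) Us" and "Bs = drop (n - d + 1) Us"
  have AB: "As @ Bs = Us" by (simp add: As_def Bs_def)
  \<comment> \<open>This also holds when \<open>d > n\<close>, where the truncated
    \<open>n - d\<close> is 0.\<close>
  have lB: "length Bs < d" using d(1) Us(3) by (simp add: Bs_def)
  have lA: "length As \<le> n - d + 1" by (simp add: As_def)
  have ABV: "set As \<subseteq> V" "set Bs \<subseteq> V" using UV AB by auto
  have CV: "f x \<in> V" if "f \<in> C" "x \<in> V" for f x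
    using subsetD[OF C that(1)] that(2) by (auto simp: endos_def)
  have "inj_on (\<lambda>f. map f As) C"
  proof (rule inj_onI, rule ccontr)
    fix f g assume fg: "f \<in> C" "g \<in> C" "map f As = map g As" "f \<noteq> g"
    define h where "h = (\<lambda>x\<in>V. f x \<ominus> g x)"
    have h: "h \<in> endos R K V" unfolding h_def using fg C by (intro endos_diff[OF V K']) auto
    have hC: "h x \<in> carrier R" if "x \<in> V" for x using h that VC by (auto simp: endos_def)
    have "h x = \<zero>" if "x \<in> set As" for x
    proof -
      have "f x = g x" "x \<in> V" using fg(3) that ABV by auto
      moreover have "f x \<in> carrier R" using CV[OF fg(1) \<open>x \<in> V\<close>] VC by blast
      ultimately show ?thesis by (simp add: h_def)
    qed
    \<comment> \<open>Since \<open>h\<close> vanishes on \<open>As\<close>, the images of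
      \<open>Bs\<close> alone span the image of \<open>h\<close>.\<close>
    then have A0: "set (map h As) \<subseteq> Span K (map h Bs)"
      using Span_subgroup_props(2)[OF K, of "map h Bs"] hC ABV by auto
    have hBC: "set (map h Bs) \<subseteq> carrier R" using hC ABV by auto
    have "h ` V = Span K (map h (As @ Bs))"
      using endos_Span[OF V K h UV] Us(4) AB by simp
    also have "\<dots> \<subseteq> Span K (map h Bs)"
      using A0 Span_base_incl[OF K hBC] by (intro mono_Span_subset[OF K _ hBC]) auto
    finally have "h ` V \<subseteq> Span K (map h Bs)" .
    moreover have "Span K (map h Bs) \<subseteq> h ` V"
    proof -
      have "Span K Bs \<subseteq> Span K Us" using AB Us(1) by (intro mono_Span_sublist[OF K]) auto
      then show ?thesis using endos_Span[OF V K h ABV(2)] Us(4) by blast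
    qed
    ultimately have "h ` V = Span K (map h Bs)" by simp
    then have "rank_dist R K V f g \<le> length Bs"
      using dim_Span_le[OF K hBC]
      by (simp add: rank_dist_def rank_def h_def[symmetric])
    then show False using d(2)[OF fg(1,2,4)] lB by simp
  qed
  moreover have "(\<lambda>f. map f As) ` C \<subseteq> {xs. set xs \<subseteq> V \<and> length xs = length As}"
    using CV subsetD[OF ABV(1)] by (simp add: image_subset_iff)
  ultimately have "card C \<le> card {xs. set xs \<subseteq> V \<and> length xs = length As}"
    using finite_lists_length_eq[OF finV] by (intro card_inj_on_le)
  also have "\<dots> = (card K ^ n) ^ length As" using card_lists_length_eq[OF finV] cV by simp
  also have "\<dots> \<le> (card K ^ n) ^ (n - d + 1)" using K1 lA by (intro power_increasing) auto
  finally show ?thesis by (simp only: power_mult)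
qed

subsection \<open>Subfields of coprime degree\<close>

lemma (in cring) Span_subfield_coprime_card:
  assumes K: "subfield K R" and L: "subfield L R" and "card K = q ^ m" "card L = q ^ n"
    and q: "q > 1" and "coprime m n" and "m > 0" "n > 0"
    and "finite (carrier R)" "card (carrier R) = q ^ (m * n)" and Ws: "set Ws = L"
  shows "Span K Ws = carrier R"
proof -
  have KC: "K \<subseteq> carrier R" and LC: "L \<subseteq> carrier R" using subfieldE(3) K L by auto
  have fin: "finite K" "finite L" using KC LC assms(9) finite_subset by auto
  let ?W = "Span K Ws"
  have WK: "subalgebra K ?W R" using Span_is_subalgebra[OF K] Ws LC by simp
  have WC: "?W \<subseteq> carrier R" by (rule subalgebra_in_carrier[OF WK])
  have finW: "finite ?W" using WC assms(9) finite_subset by blast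
  text \<open>\<open>?W\<close> is a space over both subfields, so its cardinality is a power of both \<open>q ^ m\<close> and \<open>q ^ n\<close>.\<close>
  have "b \<otimes> v \<in> ?W" if b: "b \<in> L" and v: "v \<in> ?W" for b v
  proof -
    obtain Ks where Ks: "set Ks \<subseteq> K" "v = combine Ks Ws"
      using v Span_eq_combine_set[OF K, of Ws] Ws LC by auto
    \<comment> \<open>Multiplication by \<open>b\<close> is moved into the generators, which stay in
      \<open>L\<close> because \<open>L\<close> is closed under products.\<close>
    let ?Xs = "map (\<lambda>u. u \<otimes> b) Ws"
    have X: "set ?Xs \<subseteq> set Ws" using subringE(6)[OF subfieldE(1)[OF L]] b Ws by auto
    have "b \<otimes> v = v \<otimes> b" using b v LC WC by (intro m_comm) auto
    also have "\<dots> = combine Ks ?Xs" using Ks KC LC b Ws by (simp add: combine_l_distr subset_iff)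
    also have "\<dots> \<in> Span K ?Xs" using Ks Span_eq_combine_set[OF K, of ?Xs] X Ws LC by blast
    also have "\<dots> \<subseteq> ?W" using mono_Span_sublist[OF K X] Ws LC by simp
    finally show ?thesis .
  qed
  then have WL: "subalgebra L ?W R"
    using WK by (auto simp: subalgebra_def subalgebra_axioms_def)
  define a b where "a = dim K ?W" and "b = dim L ?W"
  have ca: "card ?W = q ^ (m * a)"
    using card_dimension[OF K fin(1) finite_subalgebra_dimension[OF K WK finW]] assms(3)
    by (simp add: a_def power_mult)
  have cb: "card ?W = q ^ (n * b)"
    using card_dimension[OF L fin(2) finite_subalgebra_dimension[OF L WL finW]] assms(4)
    by (simp add: b_def power_mult)
  \<comment> \<open>Both counts of \<open>?W\<close> have the same exponent, so \<open>n\<close>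
    divides \<open>m * a\<close> and, by coprimality, \<open>a\<close>. As \<open>?W\<close>
    contains \<open>L\<close>, \<open>a\<close> is positive; hence \<open>?W\<close> has at least
    \<open>q ^ (m * n)\<close> elements.\<close>
  have "m * a = n * b" using ca cb q by simp
  then have "n dvd a" using assms(6) by (metis coprime_commute coprime_dvd_mult_right_iff dvd_triv_left)
  moreover have "a > 0"
  proof -
    have "L \<subseteq> ?W" using Span_base_incl[OF K, of Ws] Ws LC by simp
    then have "q ^ n \<le> q ^ (m * a)" using card_mono[OF finW, of L] assms(4) ca by simp
    then show ?thesis using q \<open>n > 0\<close> one_less_power[OF q, of n] by (cases a) auto
  qed
  ultimately have "n \<le> a" by (rule dvd_imp_le)
  then have "card (carrier R) \<le> card ?W" using ca q assms(10) by simp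
  then show ?thesis using card_seteq[OF assms(9) WC] by simp
qed

text \<open>The image of \<open>h\<close> is spanned over \<open>F\<close> by the images of
  \<open>Ws\<close>. A \<open>K\<close>-base of the image of \<open>L\<close> has the same
  \<open>F\<close>-span, so its length bounds the rank over \<open>F\<close>.\<close>

lemma (in cring) rank_le_rank_restrict:
  assumes F: "subfield F R" and K: "subfield K R" and L: "subfield L R"
    and KF: "K \<subseteq> F" and KL: "K \<subseteq> L" and finL: "finite L"
    and Ws: "set Ws = L" "Span F Ws = carrier R"
    and h: "h \<in> endos R F (carrier R)" and hL: "h ` L \<subseteq> L"
    and h': "restrict h L \<in> endos R K L"
  shows "rank R F (carrier R) h \<le> rank R K L (restrict h L)"
proof -
  have FC: "F \<subseteq> carrier R" and LC: "L \<subseteq> carrier R" using subfieldE(3) F L by auto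
  have "subalgebra K (h ` L) R"
    using endos_image_subalgebra[OF subfield_subalgebra[OF K L KL] K h' finL]
    by (simp add: image_restrict_eq)
  then have "dimension (dim K (h ` L)) K (h ` L)"
    using finL by (intro finite_subalgebra_dimension[OF K]) auto
  then obtain Bs where Bs: "set Bs \<subseteq> carrier R" "length Bs = dim K (h ` L)" "Span K Bs = h ` L"
    using exists_base[OF K] by blast
  have "Span K Bs \<subseteq> Span F Bs"
    using Span_eq_combine_set[OF K Bs(1)] Span_eq_combine_set[OF F Bs(1)] KF by blast
  then have "set (map h Ws) \<subseteq> Span F Bs" using Bs(3) Ws(1) by auto
  then have 1: "Span F (map h Ws) \<subseteq> Span F Bs" by (intro mono_Span_subset[OF F _ Bs(1)])
  have "set Bs \<subseteq> set (map h Ws)" using Span_base_incl[OF K Bs(1)] Bs(3) Ws(1) by auto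
  then have 2: "Span F Bs \<subseteq> Span F (map h Ws)" using hL LC Ws(1) by (intro mono_Span_sublist[OF F]) auto
  have "h ` carrier R = Span F (map h Ws)"
    using endos_Span[OF carrier_is_subalgebra[OF FC] F h, of Ws] Ws LC by simp
  then have "h ` carrier R = Span F Bs" using 1 2 by simp
  then have "rank R F (carrier R) h \<le> length Bs"
    using dim_Span_le[OF F Bs(1)] by (simp add: rank_def)
  then show ?thesis using Bs(2) by (simp add: rank_def image_restrict_eq)
qed

section \<open>Subfields of a finite field as root sets\<close>

text \<open>Lagrange's theorem in the multiplicative group of \<open>K\<close> handles nonzero
  \<open>x\<close>.\<close>

lemma (in field) subfield_pow_card:
  assumes K: "subfield K R" and "finite K" and "x \<in> K"
  shows "x [^] card K = x"
proof -
  let ?K = "R \<lparr> carrier := K \<rparr>"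
  interpret K: field ?K by (rule subfield_iff(2)[OF K])
  have K0: "card K > 0" using assms(2,3) card_gt_0_iff by blast
  show ?thesis
  proof (cases "x = \<zero>")
    case True
    then show ?thesis using K0 by (simp add: nat_pow_zero)
  next
    case False
    interpret G: group "Multiplicative_Group.mult_of ?K" by (rule K.field_mult_group)
    have "x [^]\<^bsub>Multiplicative_Group.mult_of ?K\<^esub> order (Multiplicative_Group.mult_of ?K) = \<one>\<^bsub>Multiplicative_Group.mult_of ?K\<^esub>"
      using False assms(3) by (intro G.pow_order_eq_1) simp
    then have "x [^]\<^bsub>?K\<^esub> (card K - 1) = \<one>"
      using K.order_mult_of assms(2) by (simp add: order_def Multiplicative_Group.nat_pow_mult_of)
    then have "x [^] (card K - 1) = \<one>" using nat_pow_consistent by metis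
    then have "x [^] Suc (card K - 1) = x"
      using assms(3) subfieldE(3)[OF K] by (simp add: subset_iff)
    then show ?thesis using K0 by simp
  qed
qed

text \<open>The elements of \<open>K\<close> solve the equation, which has at most
  \<open>card K\<close> solutions in a field; so inclusion of finite sets becomes equality.\<close>

lemma (in field) subfield_eq_roots:
  assumes K: "subfield K R" and fin: "finite (carrier R)"
  shows "K = {x \<in> carrier R. x [^] card K = x}"
proof (rule card_seteq)
  have KC: "K \<subseteq> carrier R" by (rule subfieldE(3)[OF K])
  have finK: "finite K" using KC fin finite_subset by blast
  have "{\<zero>, \<one>} \<subseteq> K" using subringE(2,3)[OF subfieldE(1)[OF K]] by simp
  then have K2: "card K \<ge> 2" using card_mono[OF finK, of "{\<zero>, \<one>}"] by simp
  show "finite {x \<in> carrier R. x [^] card K = x}" using fin by simp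
  show "K \<subseteq> {x \<in> carrier R. x [^] card K = x}" using KC subfield_pow_card[OF K finK] by auto
  have "x [^] (card K - 1) = \<one>" if "x \<in> carrier R" "x \<noteq> \<zero>" "x [^] card K = x" for x
  proof -
    have "x [^] (card K - 1) \<otimes> x = x [^] Suc (card K - 1)" by simp
    also have "\<dots> = \<one> \<otimes> x" using K2 that by simp
    finally show ?thesis using that by (subst (asm) m_rcancel) auto
  qed
  \<comment> \<open>Zero is split off, so that the root count is applied to
    \<open>x [^] (card K - 1) = \<one>\<close>, whose exponent is positive by
    \<open>K2\<close>.\<close>
  then have "{x \<in> carrier R. x [^] card K = x} \<subseteq> insert \<zero> {x \<in> carrier R. x [^] (card K - 1) = \<one>}"
    by auto
  then have "card {x \<in> carrier R. x [^] card K = x} \<le> card (insert \<zero> {x \<in> carrier R. x [^] (card K - 1) = \<one>})"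
    using fin by (intro card_mono) auto
  also have "\<dots> \<le> Suc (card {x \<in> carrier R. x [^] (card K - 1) = \<one>})"
    by (rule card_insert_le_m1) auto
  also have "\<dots> \<le> card K" using num_roots_le_deg[OF fin, of "card K - 1"] K2 by simp
  finally show "card {x \<in> carrier R. x [^] card K = x} \<le> card K" .
qed

text \<open>A point fixed by the power map with exponent \<open>card K\<close> is fixed by its
  iterates. This supplies the inclusions between subfields that are given only by their
  cardinalities.\<close>

lemma (in field) subfield_card_power_mono:
  assumes K: "subfield K R" and L: "subfield L R" and fin: "finite (carrier R)"
    and "card L = card K ^ j"
  shows "K \<subseteq> L"
proof
  fix x assume x: "x \<in> K"
  have KC: "K \<subseteq> carrier R" by (rule subfieldE(3)[OF K])
  have finK: "finite K" using KC fin finite_subset by blast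
  have "x [^] (card K ^ j) = x" for j
  proof (induction j)
    case (Suc j)
    have "x [^] (card K ^ Suc j) = (x [^] card K) [^] (card K ^ j)"
      using x KC by (simp add: nat_pow_pow subset_iff)
    then show ?case using Suc subfield_pow_card[OF K finK x] by simp
  qed (use x KC in auto)
  then show "x \<in> L" using subfield_eq_roots[OF L fin] assms(4) x KC by auto
qed

subsection \<open>Linearized polynomials\<close>

context UP_cring
begin

lemma lin_poly_closed:
  assumes "a \<in> {..<n} \<rightarrow> carrier R"
  shows "(\<Oplus>\<^bsub>P\<^esub> i\<in>{..<n::nat}. up_ring.monom P (a i) (Q ^ i)) \<in> carrier P"
  using assms by (intro P.finsum_closed) (simp add: Pi_def)

text \<open>Evaluation at \<open>x\<close> is a ring homomorphism, so it passes through the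
  sum.\<close>

lemma eval_lin_poly:
  assumes a: "a \<in> {..<n} \<rightarrow> carrier R" and x: "x \<in> carrier R"
  shows "UnivPoly.eval R R id x (\<Oplus>\<^bsub>P\<^esub> i\<in>{..<n::nat}. up_ring.monom P (a i) (Q ^ i)) =
    (\<Oplus>i\<in>{..<n}. a i \<otimes> x [^] (Q ^ i))"
proof -
  interpret E: UP_pre_univ_prop R R id by unfold_locales simp
  interpret H: ring_hom_cring P R "UnivPoly.eval R R id x"
    by unfold_locales (rule E.eval_ring_hom[OF x])
  have "UnivPoly.eval R R id x (\<Oplus>\<^bsub>P\<^esub> i\<in>{..<n}. up_ring.monom P (a i) (Q ^ i)) =
      (\<Oplus>i\<in>{..<n}. (UnivPoly.eval R R id x \<circ> (\<lambda>i. up_ring.monom P (a i) (Q ^ i))) i)"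
    using a by (subst H.hom_finsum) (auto simp: Pi_def comp_def)
  also have "\<dots> = (\<Oplus>i\<in>{..<n}. a i \<otimes> x [^] (Q ^ i))"
    using a x E.eval_monom by (intro R.finsum_cong') (auto simp: Pi_def)
  finally show ?thesis .
qed

text \<open>No exponent exceeds \<open>Q ^ (n - 1)\<close>; for \<open>n = 0\<close> the sum is the
  zero polynomial.\<close>

lemma lin_poly_deg_le:
  assumes a: "a \<in> {..<n} \<rightarrow> carrier R" and "Q > 0"
  shows "deg R (\<Oplus>\<^bsub>P\<^esub> i\<in>{..<n::nat}. up_ring.monom P (a i) (Q ^ i)) \<le> Q ^ (n - 1)"
proof (rule deg_aboveI)
  fix k assume k: "Q ^ (n - 1) < k"
  have "Q ^ i \<noteq> k" if "i < n" for i
  proof -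
    have "Q ^ i \<le> Q ^ (n - 1)" using that assms(2) by (intro power_increasing) auto
    then show ?thesis using k by simp
  qed
  then have "(\<Oplus>i\<in>{..<n}. up_ring.coeff P (up_ring.monom P (a i) (Q ^ i)) k) = (\<Oplus>i\<in>{..<n}. \<zero>)"
    using a by (intro R.finsum_cong') (auto simp: Pi_def)
  then show "up_ring.coeff P (\<Oplus>\<^bsub>P\<^esub> i\<in>{..<n}. up_ring.monom P (a i) (Q ^ i)) k = \<zero>"
    using a by (subst coeff_finsum) (auto simp: Pi_def)
qed (rule lin_poly_closed[OF a])

lemma lin_polysE:
  assumes "p \<in> lin_polys R Q n L"
  obtains a where "a \<in> {..<n} \<rightarrow> L" "p = (\<Oplus>\<^bsub>P\<^esub> i\<in>{..<n}. up_ring.monom P (a i) (Q ^ i))"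
  using assms by (auto simp: lin_polys_def P_def)

lemma lin_polysI:
  assumes "a \<in> {..<n} \<rightarrow> L"
  shows "(\<Oplus>\<^bsub>P\<^esub> i\<in>{..<n}. up_ring.monom P (a i) (Q ^ i)) \<in> lin_polys R Q n L"
  using assms by (auto simp: lin_polys_def P_def)

lemma lin_polys_mono: "L \<subseteq> L' \<Longrightarrow> lin_polys R Q n L \<subseteq> lin_polys R Q n L'"
  by (auto simp: lin_polys_def Pi_def)

text \<open>This lemma and the next two give a polynomial with prescribed values rather than an
  identity between polynomials. Values suffice, since they later identify the polynomial by
  injectivity of evaluation.\<close>

lemma lin_polys_zero:
  assumes "subring L R"
  obtains p where "p \<in> lin_polys R Q n L" "\<And>x. x \<in> carrier R \<Longrightarrow> UnivPoly.eval R R id x p = \<zero>"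
proof
  have L: "L \<subseteq> carrier R" "\<zero> \<in> L" using subringE[OF assms] by auto
  show "(\<Oplus>\<^bsub>P\<^esub> i\<in>{..<n}. up_ring.monom P \<zero> (Q ^ i)) \<in> lin_polys R Q n L"
    using L by (intro lin_polysI) auto
  fix x assume "x \<in> carrier R"
  then have "(\<Oplus>i\<in>{..<n}. \<zero> \<otimes> x [^] (Q ^ i)) = (\<Oplus>i\<in>{..<n}. \<zero>)"
    by (intro R.finsum_cong') auto
  then show "UnivPoly.eval R R id x (\<Oplus>\<^bsub>P\<^esub> i\<in>{..<n}. up_ring.monom P \<zero> (Q ^ i)) = \<zero>"
    using eval_lin_poly[of "\<lambda>_. \<zero>" n x Q] \<open>x \<in> carrier R\<close> by simp
qed

lemma lin_polys_add:
  assumes "subring L R" "p \<in> lin_polys R Q n L" "r \<in> lin_polys R Q n L"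
  obtains s where "s \<in> lin_polys R Q n L"
    "\<And>x. x \<in> carrier R \<Longrightarrow> UnivPoly.eval R R id x s = UnivPoly.eval R R id x p \<oplus> UnivPoly.eval R R id x r"
proof -
  have L: "L \<subseteq> carrier R" using subringE[OF assms(1)] by auto
  obtain a where a: "a \<in> {..<n} \<rightarrow> L" "p = (\<Oplus>\<^bsub>P\<^esub> i\<in>{..<n}. up_ring.monom P (a i) (Q ^ i))"
    by (rule lin_polysE[OF assms(2)])
  obtain b where b: "b \<in> {..<n} \<rightarrow> L" "r = (\<Oplus>\<^bsub>P\<^esub> i\<in>{..<n}. up_ring.monom P (b i) (Q ^ i))"
    by (rule lin_polysE[OF assms(3)])
  have ab: "a \<in> {..<n} \<rightarrow> carrier R" "b \<in> {..<n} \<rightarrow> carrier R" using a b L by auto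
  have abL: "(\<lambda>i. a i \<oplus> b i) \<in> {..<n} \<rightarrow> L" using a b subringE(7)[OF assms(1)] by auto
  show ?thesis
  proof
    show "(\<Oplus>\<^bsub>P\<^esub> i\<in>{..<n}. up_ring.monom P (a i \<oplus> b i) (Q ^ i)) \<in> lin_polys R Q n L"
      using abL by (rule lin_polysI)
    fix x assume x: "x \<in> carrier R"
    have "(\<Oplus>i\<in>{..<n}. (a i \<oplus> b i) \<otimes> x [^] (Q ^ i)) =
      (\<Oplus>i\<in>{..<n}. a i \<otimes> x [^] (Q ^ i) \<oplus> b i \<otimes> x [^] (Q ^ i))"
      using ab x by (intro R.finsum_cong') (auto simp: R.l_distr Pi_def)
    also have "\<dots> = (\<Oplus>i\<in>{..<n}. a i \<otimes> x [^] (Q ^ i)) \<oplus> (\<Oplus>i\<in>{..<n}. b i \<otimes> x [^] (Q ^ i))"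
      using ab x by (intro R.finsum_addf) auto
    finally show "UnivPoly.eval R R id x (\<Oplus>\<^bsub>P\<^esub> i\<in>{..<n}. up_ring.monom P (a i \<oplus> b i) (Q ^ i)) =
        UnivPoly.eval R R id x p \<oplus> UnivPoly.eval R R id x r"
      using eval_lin_poly[OF _ x, of "\<lambda>i. a i \<oplus> b i" n Q] ab
      by (simp add: a(2) b(2) eval_lin_poly[OF _ x] Pi_def)
  qed
qed

lemma lin_polys_smult:
  assumes "subring L R" "c \<in> L" "p \<in> lin_polys R Q n L"
  obtains s where "s \<in> lin_polys R Q n L"
    "\<And>x. x \<in> carrier R \<Longrightarrow> UnivPoly.eval R R id x s = c \<otimes> UnivPoly.eval R R id x p"
proof -
  have L: "L \<subseteq> carrier R" using subringE[OF assms(1)] by auto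
  obtain a where a: "a \<in> {..<n} \<rightarrow> L" "p = (\<Oplus>\<^bsub>P\<^esub> i\<in>{..<n}. up_ring.monom P (a i) (Q ^ i))"
    by (rule lin_polysE[OF assms(3)])
  have c: "c \<in> carrier R" "a \<in> {..<n} \<rightarrow> carrier R" using a assms(2) L by auto
  have ca: "(\<lambda>i. c \<otimes> a i) \<in> {..<n} \<rightarrow> L" using a assms(2) subringE(6)[OF assms(1)] by auto
  show ?thesis
  proof
    show "(\<Oplus>\<^bsub>P\<^esub> i\<in>{..<n}. up_ring.monom P (c \<otimes> a i) (Q ^ i)) \<in> lin_polys R Q n L"
      using ca by (rule lin_polysI)
    fix x assume x: "x \<in> carrier R"
    have "(\<Oplus>i\<in>{..<n}. (c \<otimes> a i) \<otimes> x [^] (Q ^ i)) =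
      (\<Oplus>i\<in>{..<n}. c \<otimes> (a i \<otimes> x [^] (Q ^ i)))"
      using c x by (intro R.finsum_cong') (auto simp: R.m_assoc Pi_def)
    also have "\<dots> = c \<otimes> (\<Oplus>i\<in>{..<n}. a i \<otimes> x [^] (Q ^ i))"
      using c x by (intro R.finsum_rdistr[symmetric]) auto
    finally show "UnivPoly.eval R R id x (\<Oplus>\<^bsub>P\<^esub> i\<in>{..<n}. up_ring.monom P (c \<otimes> a i) (Q ^ i)) =
        c \<otimes> UnivPoly.eval R R id x p"
      using eval_lin_poly[OF _ x, of "\<lambda>i. c \<otimes> a i" n Q] c
      by (simp add: a(2) eval_lin_poly[OF _ x] Pi_def)
  qed
qed

lemma lin_polys_eval_closed:
  assumes "subring L R" "p \<in> lin_polys R Q n L" "x \<in> L"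
  shows "UnivPoly.eval R R id x p \<in> L"
proof -
  have L: "L \<subseteq> carrier R" using subringE[OF assms(1)] by auto
  obtain a where a: "a \<in> {..<n} \<rightarrow> L" "p = (\<Oplus>\<^bsub>P\<^esub> i\<in>{..<n}. up_ring.monom P (a i) (Q ^ i))"
    by (rule lin_polysE[OF assms(2)])
  have pw: "x [^] (k::nat) \<in> L" for k
    using assms(3) subringE(3,6)[OF assms(1)] by (induction k) auto
  have t: "a i \<otimes> x [^] (Q ^ i) \<in> L" if "i < n" for i
    using a that pw subringE(6)[OF assms(1)] by auto
  \<comment> \<open>The sum is formed in \<open>R\<close>; that it stays in \<open>L\<close> is
    shown by induction on the number of terms.\<close>
  have "j \<le> n \<Longrightarrow> (\<Oplus>i\<in>{..<j}. a i \<otimes> x [^] (Q ^ i)) \<in> L" for j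
  proof (induction j)
    case 0 then show ?case using subringE(2)[OF assms(1)] by simp
  next
    case (Suc j)
    have "(\<Oplus>i\<in>{..<Suc j}. a i \<otimes> x [^] (Q ^ i)) =
        a j \<otimes> x [^] (Q ^ j) \<oplus> (\<Oplus>i\<in>{..<j}. a i \<otimes> x [^] (Q ^ i))"
      unfolding lessThan_Suc using t L Suc.prems by (intro R.finsum_insert) (auto simp: Pi_def subset_iff)
    then show ?case using Suc t subringE(7)[OF assms(1)] by simp
  qed
  then show ?thesis using a assms(3) L eval_lin_poly[of a n x Q] by (auto simp: Pi_def subset_iff)
qed

end

text \<open>The difference has degree at most \<open>Q ^ (n - 1)\<close>, less than the number of
  field elements, so it cannot vanish everywhere unless it is zero. Thus polynomials and maps can be
  counted interchangeably.\<close>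

lemma (in field) lin_polys_eval_inj:
  assumes fin: "finite (carrier R)" and card: "Q ^ n \<le> card (carrier R)" and "Q > 1" "n > 0"
    and p: "p \<in> lin_polys R Q n (carrier R)" and r: "r \<in> lin_polys R Q n (carrier R)"
    and eq: "\<And>x. x \<in> carrier R \<Longrightarrow> UnivPoly.eval R R id x p = UnivPoly.eval R R id x r"
  shows "p = r"
proof (rule ccontr)
  assume ne: "p \<noteq> r"
  interpret U: UP_domain R "UP R" by unfold_locales
  have *: "u \<in> carrier (UP R) \<and> deg R u \<le> Q ^ (n - 1)" if "u \<in> lin_polys R Q n (carrier R)" for u
    by (rule U.lin_polysE[OF that]) (use assms(3) U.lin_poly_closed U.lin_poly_deg_le in simp)
  have pr: "p \<in> carrier (UP R)" "r \<in> carrier (UP R)" using * p r by auto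
  let ?d = "p \<ominus>\<^bsub>UP R\<^esub> r"
  have d: "?d \<in> carrier (UP R)" "?d \<noteq> \<zero>\<^bsub>UP R\<^esub>" using pr ne by auto
  have "deg R ?d \<le> Q ^ (n - 1)"
  proof (rule U.deg_aboveI)
    fix k assume k: "Q ^ (n - 1) < k"
    have "up_ring.coeff (UP R) p k = \<zero>" "up_ring.coeff (UP R) r k = \<zero>"
      using *[OF p] *[OF r] k by (auto intro: U.deg_aboveD)
    then show "up_ring.coeff (UP R) ?d k = \<zero>" using pr by (simp add: minus_eq)
  qed (rule d(1))
  also have "\<dots> < Q ^ n" using assms(3,4) by (intro power_strict_increasing) auto
  finally have lt: "deg R ?d < card (carrier R)" using card by simp
  have "UnivPoly.eval R R id x ?d = \<zero>" if "x \<in> carrier R" for x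
    using that pr eq[OF that] U.evalRR_sub[OF pr that] U.carrier_evalRR by simp
  then have "{x \<in> carrier R. UnivPoly.eval R R id x ?d = \<zero>} = carrier R" by auto
  then show False using U.roots_bound[OF d fin] lt by simp
qed

subsection \<open>Restriction to a subfield\<close>

lemma (in ring) endos_restrict:
  assumes "subalgebra F V R" "K \<subseteq> F" and L: "subalgebra K L R" and "L \<subseteq> V"
    and f: "f \<in> endos R F V" and "f ` L \<subseteq> L"
  shows "restrict f L \<in> endos R K L"
proof -
  interpret L: subalgebra K L R by (rule L)
  have "x \<oplus> y \<in> L" if "x \<in> L" "y \<in> L" for x y using L.m_closed that by simp
  then show ?thesis
    using assms(2,4) f assms(6) L.smult_closed by (simp add: endos_def image_subset_iff subset_iff)
qed

section \<open>Rank distance and minimum distance\<close>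

lemma (in ring) dim_zero: "subfield K R \<Longrightarrow> dim K {\<zero>} = 0"
  using dimI[OF _ zero_dim] by (simp add: over_def)

text \<open>Serves to conclude that two maps at positive distance are distinct.\<close>

lemma (in cring) rank_dist_self:
  assumes "subfield K R" "subalgebra K V R" "f \<in> endos R K V"
  shows "rank_dist R K V f f = 0"
proof -
  have VC: "V \<subseteq> carrier R" by (rule subalgebra_in_carrier[OF assms(2)])
  have z: "\<zero> \<in> V" using subgroup.one_closed[OF subalgebra.axioms(1)[OF assms(2)]] by simp
  have "f x \<ominus> f x = \<zero>" if "x \<in> V" for x
    using assms(3) that VC by (auto simp: endos_def subset_iff)
  then have "(\<lambda>x\<in>V. f x \<ominus> f x) ` V = {\<zero>}" using z by (auto simp: image_iff)
  then show ?thesis using dim_zero[OF assms(1)] by (simp add: rank_dist_def rank_def)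
qed

text \<open>The image of the difference is spanned by the images of \<open>n\<close> base vectors.
  The bound makes the truncated subtraction in \<open>mrd_code\<close> exact.\<close>

lemma (in cring) rank_dist_le_dimension:
  assumes K: "subfield K R" and n: "dimension n K V"
    and fg: "f \<in> endos R K V" "g \<in> endos R K V"
  shows "rank_dist R K V f g \<le> n"
proof -
  have V: "subalgebra K V R"
    by (rule finite_dimension_imp_subalgebra[OF K finite_dimensionI[OF n]])
  have VC: "V \<subseteq> carrier R" by (rule subalgebra_in_carrier[OF V])
  obtain Us where Us: "set Us \<subseteq> carrier R" "length Us = n" "Span K Us = V"
    using exists_base[OF K n] by blast
  have UV: "set Us \<subseteq> V" using Span_base_incl[OF K Us(1)] Us(3) by simp
  let ?h = "\<lambda>x\<in>V. f x \<ominus> g x"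
  have h: "?h \<in> endos R K V" by (rule endos_diff[OF V subfieldE(3)[OF K] fg])
  then have "set (map ?h Us) \<subseteq> V" using UV unfolding endos_def by fastforce
  then have "dim K (Span K (map ?h Us)) \<le> length (map ?h Us)"
    using VC by (intro dim_Span_le[OF K]) (rule subset_trans)
  then show ?thesis using endos_Span[OF V K h UV] Us by (simp add: rank_dist_def rank_def)
qed

text \<open>Ensures that \<open>Min\<close> in \<open>min_dist\<close> ranges over a finite
  set.\<close>

lemma finite_rank_dists:
  "finite C \<Longrightarrow> finite {rank_dist R K V f g | f g. f \<in> C \<and> g \<in> C \<and> f \<noteq> g}"
  by (rule finite_subset[of _ "(\<lambda>(f, g). rank_dist R K V f g) ` (C \<times> C)"]) auto

lemma min_dist_le:
  assumes "finite C" "f \<in> C" "g \<in> C" "f \<noteq> g"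
  shows "min_dist R K V C \<le> rank_dist R K V f g"
  unfolding min_dist_def using assms by (intro Min_le finite_rank_dists) auto

lemma min_dist_attained:
  assumes "finite C" "\<exists>f\<in>C. \<exists>g\<in>C. f \<noteq> g"
  obtains f g where "f \<in> C" "g \<in> C" "f \<noteq> g" "min_dist R K V C = rank_dist R K V f g"
proof -
  have "min_dist R K V C \<in> {rank_dist R K V f g | f g. f \<in> C \<and> g \<in> C \<and> f \<noteq> g}"
    unfolding min_dist_def using assms by (intro Min_in finite_rank_dists) auto
  then show ?thesis using that by auto
qed

text \<open>The equality of minimum distances fixes which MRD parameters are meant: a code on
  \<open>Fqn\<close> with larger minimum distance could also attain the Singleton bound, but with
  fewer than \<open>q ^ (n * k)\<close> elements.\<close>

theorem theorem3p2:
  fixes R :: "('a, 'b) ring_scheme"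
    and q m n k :: nat
    and Fq Fqm Fqn :: "'a set"
    and M M' :: "(nat \<Rightarrow> 'a) set"
  assumes "primepow q" and "m > 0" and "n > 0" and "gcd n m = 1" and "k > 0" and "k < n"
    and "field R" and "card (carrier R) = q ^ (m * n)"
    and "subfield Fq R" and "card Fq = q"
    and "subfield Fqm R" and "card Fqm = q ^ m"
    and "subfield Fqn R" and "card Fqn = q ^ n"
    and "M \<subseteq> lin_polys R (q ^ m) n (carrier R)"
    and "linear_code R Fqm (carrier R) (poly_map R (carrier R) ` M)"
    and "mrd_code R Fqm (carrier R) (poly_map R (carrier R) ` M)"
    and "card M = q ^ (m * n * k)"
    and "M' = M \<inter> lin_polys R (q ^ m) n Fqn"
  shows "(linear_code R Fq Fqn (poly_map R Fqn ` M') \<and>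
          mrd_code R Fq Fqn (poly_map R Fqn ` M') \<and>
          min_dist R Fq Fqn (poly_map R Fqn ` M') =
            min_dist R Fqm (carrier R) (poly_map R (carrier R) ` M))
         \<longleftrightarrow> card M' = q ^ (n * k)"
proof -
  interpret field R by (rule assms(7))
  interpret U: UP_domain R "UP R" by unfold_locales
  let ?C = "carrier R"
  define F where "F = poly_map R ?C"
  define G where "G = poly_map R Fqn"
  have q: "q > 1" using assms(1) by (rule primepow_gt_Suc_0[unfolded One_nat_def[symmetric]])
  have fin: "finite ?C" using assms(8) q by (intro card_ge_0_finite) simp
  note Fq = assms(9) and Fqm = assms(11) and Fqn = assms(13)
  have FqC: "Fq \<subseteq> ?C" "Fqm \<subseteq> ?C" "Fqn \<subseteq> ?C" using subfieldE(3) Fq Fqm Fqn by auto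
  then have finF: "finite Fq" "finite Fqm" "finite Fqn" by (auto intro: finite_subset[OF _ fin])
  have FqFqm: "Fq \<subseteq> Fqm" and FqFqn: "Fq \<subseteq> Fqn"
    using subfield_card_power_mono[OF Fq _ fin] Fqm Fqn assms(10,12,14) by auto
  have sFqn: "subalgebra Fq Fqn R" by (rule subfield_subalgebra[OF Fq Fqn FqFqn])
  have sC: "subalgebra Fqm ?C R" by (rule carrier_is_subalgebra[OF FqC(2)])
  have qm: "q ^ m > 1" using q assms(2) by (rule one_less_power)
  have dimC: "dimension n Fqm ?C"
    using qm assms(8,12) finF fin by (intro dimension_of_card[OF Fqm sC]) (auto simp: power_mult)
  have dimFqn: "dimension n Fq Fqn"
    using q assms(10,14) finF by (intro dimension_of_card[OF Fq sFqn]) auto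
  obtain Ws where Ws: "set Ws = Fqn" using finite_list[OF finF(3)] by blast
  have span: "Span Fqm Ws = ?C"
    using assms(4) Span_subfield_coprime_card[OF Fqm Fqn assms(12,14) q _ assms(2,3) fin assms(8) Ws]
    by (simp add: coprime_iff_gcd_eq_1 gcd.commute)

  have eqI: "p = r" if "p \<in> lin_polys R (q ^ m) n ?C" "r \<in> lin_polys R (q ^ m) n ?C"
      "\<And>x. x \<in> ?C \<Longrightarrow> UnivPoly.eval R R id x p = UnivPoly.eval R R id x r" for p r
    using that qm assms(3,8) by (intro lin_polys_eval_inj[OF fin, of "q ^ m" n]) (auto simp: power_mult)
  have F_app: "F p x = UnivPoly.eval R R id x p" if "x \<in> ?C" for p x
    using that by (simp add: F_def poly_map_def)
  \<comment> \<open>\<open>card M\<close> counts polynomials, the MRD equality counts maps;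
    injectivity identifies the two counts.\<close>
  have injF: "inj_on F (lin_polys R (q ^ m) n ?C)"
    by (rule inj_onI, rule eqI) (auto simp: F_app[symmetric])
  have M'M: "M' \<subseteq> M" and M'L: "M' \<subseteq> lin_polys R (q ^ m) n Fqn" using assms(19) by auto
  have G_eq: "G p = restrict (F p) Fqn" for p
    using FqC(3) by (auto simp: F_def G_def poly_map_def restrict_def fun_eq_iff)
  have F_endo: "F p \<in> endos R Fqm ?C" if "p \<in> M" for p
    using assms(16) that by (auto simp: linear_code_def F_def)
  have F_Fqn: "F p ` Fqn \<subseteq> Fqn" if "p \<in> M'" for p
    using U.lin_polys_eval_closed[OF subfieldE(1)[OF Fqn] subsetD[OF M'L that]] F_app FqC(3) by auto
  have G_endo: "G p \<in> endos R Fq Fqn" if "p \<in> M'" for p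
    unfolding G_eq using that M'M by (intro endos_restrict[OF sC FqFqm sFqn FqC(3) F_endo F_Fqn]) auto

  have finM: "finite M" using assms(18) q by (intro card_ge_0_finite) simp
  define d where "d = min_dist R Fqm ?C (F ` M)"
  have two: "\<exists>f\<in>F ` M. \<exists>g\<in>F ` M. f \<noteq> g" using assms(17) by (simp add: mrd_code_def F_def)
  obtain f0 g0 where fg0: "f0 \<in> F ` M" "g0 \<in> F ` M" "d = rank_dist R Fqm ?C f0 g0"
    unfolding d_def by (rule min_dist_attained[OF finite_imageI[OF finM] two])
  have dn: "d \<le> n" unfolding fg0(3) using fg0(1,2) F_endo by (intro rank_dist_le_dimension[OF Fqm dimC]) auto
  have dimC': "dim Fqm ?C = n" using dimI[OF Fqm dimC] by (simp add: over_def)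
  have dimFqn': "dim Fq Fqn = n" using dimI[OF Fq dimFqn] by (simp add: over_def)
  \<comment> \<open>Comparing the given size of \<open>M\<close> with the Singleton equality
    expresses \<open>k\<close> by the minimum distance \<open>d\<close>.\<close>
  have "card (F ` M) = card M" by (rule card_image[OF inj_on_subset[OF injF assms(15)]])
  then have "q ^ (m * n * k) = q ^ (m * (n * (n - d + 1)))"
    using assms(12,17,18) by (simp only: mrd_code_def d_def F_def dimC' power_mult)
  then have "m * n * k = m * (n * (n - d + 1))" using q by (metis power_inject_exp)
  then have k: "k = n - d + 1" using assms(2,3) by (simp only: mult.assoc nat_mult_eq_cancel1)
  \<comment> \<open>\<open>d = 0\<close> would give \<open>k = n + 1\<close>, against
    \<open>k < n\<close>.\<close>
  have d0: "d > 0" using k assms(6) by (cases d) auto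

  have rank: "d \<le> rank_dist R Fq Fqn (G p) (G r)" if pr: "p \<in> M'" "r \<in> M'" "p \<noteq> r" for p r
  proof -
    \<comment> \<open>\<open>h\<close> restricts to the difference of the restricted maps, so
      comparing its two ranks compares the two distances.\<close>
    define h where "h = (\<lambda>x\<in>?C. F p x \<ominus>\<^bsub>R\<^esub> F r x)"
    have prM: "p \<in> M" "r \<in> M" using pr M'M by auto
    have "F p \<noteq> F r" using injF prM assms(15) pr(3) by (auto dest: inj_onD)
    then have "d \<le> rank_dist R Fqm ?C (F p) (F r)"
      unfolding d_def using finM prM by (intro min_dist_le) auto
    also have "\<dots> = rank R Fqm ?C h" by (simp add: rank_dist_def h_def)
    also have "\<dots> \<le> rank R Fq Fqn (restrict h Fqn)"
    proof (rule rank_le_rank_restrict[OF Fqm Fq Fqn FqFqm FqFqn finF(3) Ws span])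
      show h: "h \<in> endos R Fqm ?C"
        unfolding h_def using prM by (intro endos_diff[OF sC FqC(2)] F_endo)
      show hL: "h ` Fqn \<subseteq> Fqn"
      proof (rule image_subsetI)
        fix x assume x: "x \<in> Fqn"
        then have "F p x \<in> Fqn" "F r x \<in> Fqn" using F_Fqn pr by auto
        then show "h x \<in> Fqn" using x FqC(3) subringE(5,7)[OF subfieldE(1)[OF Fqn]]
          by (auto simp: h_def minus_eq)
      qed
      show "restrict h Fqn \<in> endos R Fq Fqn" by (rule endos_restrict[OF sC FqFqm sFqn FqC(3) h hL])
    qed
    also have "restrict h Fqn = (\<lambda>x\<in>Fqn. G p x \<ominus>\<^bsub>R\<^esub> G r x)"
      using FqC(3) by (auto simp: h_def G_eq restrict_def fun_eq_iff)
    finally show ?thesis unfolding rank_dist_def .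
  qed
  \<comment> \<open>Equal restrictions would be at distance 0, below \<open>d\<close>.\<close>
  have "G p \<noteq> G r" if "p \<in> M'" "r \<in> M'" "p \<noteq> r" for p r
    using rank[OF that] rank_dist_self[OF Fq sFqn G_endo[OF that(2)]] d0 by auto
  then have "inj_on G M'" by (meson inj_onI)
  then have cardG: "card (G ` M') = card M'" by (rule card_image)

  show ?thesis
    unfolding F_def[symmetric] G_def[symmetric] d_def[symmetric]
  proof
    assume "linear_code R Fq Fqn (G ` M') \<and> mrd_code R Fq Fqn (G ` M') \<and> min_dist R Fq Fqn (G ` M') = d"
    \<comment> \<open>With minimum distance \<open>d\<close>, the Singleton equality has the
      exponent \<open>n * k\<close>.\<close>
    then have "card (G ` M') = q ^ (n * (n - d + 1))"
      by (simp add: mrd_code_def dimFqn' assms(10))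
    then show "card M' = q ^ (n * k)" using cardG k by simp
  next
    assume card: "card M' = q ^ (n * k)"
    have GE: "G ` M' \<subseteq> endos R Fq Fqn" using G_endo by auto
    have finG: "finite (G ` M')" using finM M'M finite_subset by auto
    \<comment> \<open>\<open>n * k\<close> is positive, so there are two distinct codewords and the
      minimum distance is attained.\<close>
    have "card (G ` M') > 1" using cardG card one_less_power[OF q, of "n * k"] assms(3,5) by simp
    then have two: "\<exists>f\<in>G ` M'. \<exists>g\<in>G ` M'. f \<noteq> g"
      using card_le_Suc0_iff_eq[OF finG] by (metis One_nat_def not_less)
    define e where "e = min_dist R Fq Fqn (G ` M')"
    obtain f g where fg: "f \<in> G ` M'" "g \<in> G ` M'" "f \<noteq> g" "e = rank_dist R Fq Fqn f g"
      unfolding e_def by (rule min_dist_attained[OF finG two])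
    then obtain p r where pr: "p \<in> M'" "r \<in> M'" "f = G p" "g = G r" by auto
    have "d \<le> e" using rank[OF pr(1,2)] pr(3,4) fg(3,4) by auto
    \<comment> \<open>Needed for \<open>n - e\<close> to be exact when \<open>e\<close> is compared
      with \<open>d\<close>.\<close>
    have "e \<le> n" unfolding fg(4) pr(3,4) by (intro rank_dist_le_dimension[OF Fq dimFqn] G_endo pr)
    \<comment> \<open>The bound for distance \<open>e\<close> yields
      \<open>k \<le> n - e + 1\<close>, hence \<open>e \<le> d\<close>.\<close>
    have "card (G ` M') \<le> card Fq ^ (n * (n - e + 1))"
    proof (rule singleton_bound[OF Fq finF(1) dimFqn GE])
      show "e > 0" using \<open>d \<le> e\<close> d0 by simp
    qed (unfold e_def, rule min_dist_le[OF finG])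
    then have "n * k \<le> n * (n - e + 1)" using cardG card q assms(10) by (simp add: power_increasing_iff)
    then have "k \<le> n - e + 1" using assms(3) by (simp only: nat_mult_le_cancel1)
    then have "e = d" using \<open>d \<le> e\<close> \<open>e \<le> n\<close> k by simp
    have "mrd_code R Fq Fqn (G ` M')"
      unfolding mrd_code_def dimFqn' e_def[symmetric] \<open>e = d\<close>
      using GE two cardG card k assms(10) by simp
    moreover have "linear_code R Fq Fqn (G ` M')"
    proof -
      text \<open>
        \<open>M\<close> is closed under the code operations only as a set of maps. Evaluation being injective
        on \<open>lin_polys\<close>, a combination of elements of \<open>M'\<close> is given by a polynomial that lies in
        \<open>M\<close> and has coefficients in \<open>Fqn\<close>.
      \<close>
      have closed: "(\<lambda>x\<in>Fqn. f x) \<in> G ` M'"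
        if f: "(\<lambda>x\<in>?C. f x) \<in> F ` M" and s: "s \<in> lin_polys R (q ^ m) n Fqn"
          "\<And>x. x \<in> ?C \<Longrightarrow> UnivPoly.eval R R id x s = f x" for f s
      proof -
        have s': "s \<in> lin_polys R (q ^ m) n ?C" using s(1) U.lin_polys_mono[OF FqC(3)] by blast
        obtain t where t: "t \<in> M" "F t = (\<lambda>x\<in>?C. f x)" using f by auto
        have "F s = F t" unfolding t(2) using s(2) by (auto simp: F_def poly_map_def restrict_def)
        then have "s = t" using injF s' t(1) assms(15) by (auto dest: inj_onD)
        then have "s \<in> M'" using s(1) t(1) assms(19) by simp
        moreover have "G s = (\<lambda>x\<in>Fqn. f x)"
          using FqC(3) s(2) by (auto simp: G_def poly_map_def restrict_def fun_eq_iff)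
        ultimately show ?thesis by (metis imageI)
      qed
      have RL: "subring Fqn R" by (rule subfieldE(1)[OF Fqn])
      have lin: "(\<lambda>x\<in>?C. \<zero>\<^bsub>R\<^esub>) \<in> F ` M"
          "\<And>f g. f \<in> F ` M \<Longrightarrow> g \<in> F ` M \<Longrightarrow> (\<lambda>x\<in>?C. f x \<oplus>\<^bsub>R\<^esub> g x) \<in> F ` M"
          "\<And>c f. c \<in> Fqm \<Longrightarrow> f \<in> F ` M \<Longrightarrow> (\<lambda>x\<in>?C. c \<otimes>\<^bsub>R\<^esub> f x) \<in> F ` M"
        using assms(16) unfolding linear_code_def F_def by blast+
      have zero: "(\<lambda>x\<in>Fqn. \<zero>\<^bsub>R\<^esub>) \<in> G ` M'"
        by (rule U.lin_polys_zero[OF RL], rule closed[OF lin(1)]) auto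
      have add: "(\<lambda>x\<in>Fqn. G p x \<oplus>\<^bsub>R\<^esub> G r x) \<in> G ` M'" if pr: "p \<in> M'" "r \<in> M'" for p r
      proof -
        obtain s where "s \<in> lin_polys R (q ^ m) n Fqn"
          "\<And>x. x \<in> ?C \<Longrightarrow> UnivPoly.eval R R id x s = F p x \<oplus>\<^bsub>R\<^esub> F r x"
          using U.lin_polys_add[OF RL subsetD[OF M'L pr(1)] subsetD[OF M'L pr(2)]] F_app by metis
        then have "(\<lambda>x\<in>Fqn. F p x \<oplus>\<^bsub>R\<^esub> F r x) \<in> G ` M'"
          using pr M'M by (intro closed[OF lin(2)]) auto
        then show ?thesis by (simp add: G_eq cong: restrict_cong)
      qed
      \<comment> \<open>A scalar in \<open>Fq\<close> lies in \<open>Fqm\<close>, so the product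
        stays in the code of \<open>M\<close>, and in \<open>Fqn\<close>, so the coefficients stay
        in \<open>Fqn\<close>.\<close>
      have smult: "(\<lambda>x\<in>Fqn. c \<otimes>\<^bsub>R\<^esub> G p x) \<in> G ` M'" if cp: "c \<in> Fq" "p \<in> M'" for c p
      proof -
        obtain s where "s \<in> lin_polys R (q ^ m) n Fqn"
          "\<And>x. x \<in> ?C \<Longrightarrow> UnivPoly.eval R R id x s = c \<otimes>\<^bsub>R\<^esub> F p x"
          using U.lin_polys_smult[OF RL _ subsetD[OF M'L cp(2)], of c] cp(1) FqFqn F_app
          by (metis subsetD)
        then have "(\<lambda>x\<in>Fqn. c \<otimes>\<^bsub>R\<^esub> F p x) \<in> G ` M'"
          using cp M'M FqFqm by (intro closed[OF lin(3)]) auto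
        then show ?thesis by (simp add: G_eq cong: restrict_cong)
      qed
      show ?thesis unfolding linear_code_def using GE zero add smult by blast
    qed
    ultimately show "linear_code R Fq Fqn (G ` M') \<and> mrd_code R Fq Fqn (G ` M') \<and>
        min_dist R Fq Fqn (G ` M') = d"
      using \<open>e = d\<close> by (simp add: e_def)
  qed
qed

end
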